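(* Let $T=(\mathcal V,\mathcal E)$ be an $\mathbb R^n$-refinement tree with set of leaves $\mathcal L\subset\mathcal V$, let $\Phi=[\phi_1\ \cdots\ \phi_{p_0}]\in\mathbb R^{n\times p_0}$ be the initial basis (of full column rank), and consider the refinement algorithm described in the context with full-order-model tolerance $\varepsilon>0$. Suppose that for every leaf $\mathbb L\in\mathcal L$ there exists an index $i(\mathbb L)\in\{1,\ldots,p_0\}$ such that $P_{\mathbb L}(\phi_{i(\mathbb L)})\neq 0$. Then one of the following must occur: 1. the refinement algorithm computes (at some iteration) a solution $x$ satisfying the full-order-model equations to within tolerance $\varepsilon$, i.e. $\|r(x)\|_2<\varepsilon$; 2. the range of the refined basis $V$ converges to $\mathbb R^n$, i.e. $\mathrm{range}(V)=\mathbb R^n$ from some iteration on.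
   Context: **Orthogonal decompositions.** $\mathbb R^n$ carries the Euclidean inner product; $P_{\mathbb U}$ is the orthogonal projection onto a subspace $\mathbb U$. An orthogonal decomposition of an inner-product space $\mathbb V$ is a finite set $\{\mathbb U_1,\ldots,\mathbb U_m\}$ of nontrivial (nonzero) subspaces of $\mathbb V$ that are pairwise orthogonal and sum to $\mathbb V$. **Refinement tree.** An $\mathbb R^n$-refinement tree $T=(\mathcal V,\mathcal E)$ is a finite rooted tree (directed acyclic graph in which every vertex has in-degree one except a unique root of in-degree zero) whose vertices are subspaces of $\mathbb R^n$ such that: the root is $\mathbb R^n$; for every non-leaf vertex $\mathbb U$ the set $C_T(\mathbb U)$ of its children is an orthogonal decomposition of $\mathbb U$; every leaf (vertex without children) has dimension one. $\mathcal L$ is the set of leaves. A frontier of $T$ is an orthogonal decomposition $\mathcal F$ of $\mathbb R^n$ with $\mathcal F\subset\mathcal V$. The $T$-refinement of a vertex is $R_T(\mathbb U)=C_T(\mathbb U)$ if $\mathbb U$ is not a leaf and $R_T(\mathbb U)=\{\mathbb U\}$ if it is. **Algorithm.** Given: a residual $r:\mathbb R^n\to\mathbb R^n$ and a quantity-of-interest functional $g:\mathbb R^n\to\mathbb R$, both twice continuously differentiable; a reference state $\bar x\in\mathbb R^n$; the full-column-rank initial basis $\Phi=[\phi_1\cdots\phi_{p_0}]$; a tolerance $\varepsilon>0$; and initial frontiers $\mathcal F_1,\ldots,\mathcal F_{p_0}$ of $T$ (by default $\mathcal F_i=\{\mathbb R^n\}$). The algorithm repeats the following iteration. 1. Form the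 refined basis $V$, the matrix whose columns are $v_{(i,\mathbb U)}=P_{\mathbb U}(\phi_i)$, indexed by the disjoint union $\bar{\mathcal F}^H=\{(i,\mathbb U): 1\le i\le p_0,\ \mathbb U\in\mathcal F_i\}$. 2. Compute a reduced solution $\hat x$ of $V^T r(\bar x+V\hat x)=0$ (up to a prescribed reduced-order-model tolerance), and set $x=\bar x+V\hat x$. 3. If $\|r(x)\|_2<\varepsilon$, stop. 4. Otherwise compute the coarse adjoint $\hat y\in\mathbb R^{\bar{\mathcal F}^H}$ solving $[V^T\frac{\partial r}{\partial x}(x)V]^T\hat y=V^T\frac{\partial g}{\partial x}(x)^T$. For each $(i,\mathbb U)\in\bar{\mathcal F}^H$ and $\mathbb W\in R_T(\mathbb U)$ set the fine error indicator $\delta^h_{(i,\mathbb W)}=\left|\hat y_{(i,\mathbb U)}\,P_{\mathbb W}(\phi_i)^T r(x)\right|$ if $\mathbb W\notin\mathcal L$, and $\delta^h_{(i,\mathbb W)}=0$ if $\mathbb W\in\mathcal L$. Set the coarse error indicator $\delta^H_{(i,\mathbb U)}=\sum_{\mathbb W\in R_T(\mathbb U)}\delta^h_{(i,\mathbb W)}$. 5. Let $\eta$ be the average of $\delta^H$ over $\bar{\mathcal F}^H$ and $S_i=\{\mathbb U\in\mathcal F_i:\delta^H_{(i,\mathbb U)}\ge\eta\}$. Replace each $\mathcal F_i$ by its partial refinement $(\mathcal F_i\setminus S_i)\cup\bigcup_{\mathbb U\in S_i}R_T(\mathbb U)$ and return to step 1. It is understood that the computations in steps 2 and 4 can be carried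 out (i.e. they return some vectors $\hat x$, $\hat y$) at every iteration. *)

theory Defs
  imports "HOL-Analysis.Analysis"
begin

section \<open>Orthogonal decompositions and refinement trees\<close>

text \<open>The last conjunct of the following definition is the Minkowski sum of the family
  (\<^theory>\<open>HOL-Library.Set_Algebras\<close>), that is, the sum of subspaces.\<close>

definition orthogonal_decomposition :: "'a::real_inner set \<Rightarrow> 'a set set \<Rightarrow> bool" where
  "orthogonal_decomposition W D \<longleftrightarrow>
     finite D \<and>
     (\<forall>U\<in>D. subspace U \<and> U \<subseteq> W \<and> U \<noteq> {0}) \<and>
     pairwise (\<lambda>A B. \<forall>a\<in>A. \<forall>b\<in>B. orthogonal a b) D \<and>
     (\<Sum>U\<in>D. U) = W"

definition orth_proj :: "'a::real_inner set \<Rightarrow> 'a \<Rightarrow> 'a" where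
  "orth_proj U x = (THE p. p \<in> U \<and> (\<forall>u\<in>U. orthogonal (x - p) u))"

definition children :: "('v \<times> 'v) set \<Rightarrow> 'v \<Rightarrow> 'v set" where
  "children \<E> U = {W. (U, W) \<in> \<E>}"

definition leaves :: "'v set \<Rightarrow> ('v \<times> 'v) set \<Rightarrow> 'v set" where
  "leaves \<V> \<E> = {U \<in> \<V>. children \<E> U = {}}"

definition refinement_tree ::
    "(real^'n) set set \<Rightarrow> ((real^'n) set \<times> (real^'n) set) set \<Rightarrow> bool" where
  "refinement_tree \<V> \<E> \<longleftrightarrow>
     finite \<V> \<and> \<E> \<subseteq> \<V> \<times> \<V> \<and> acyclic \<E> \<and>
     (\<forall>U\<in>\<V>. subspace U) \<and>
     UNIV \<in> \<V> \<and>
     (\<forall>W\<in>\<V>. card {U. (U, W) \<in> \<E>} = (if W = UNIV then 0 else 1)) \<and>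
     (\<forall>U\<in>\<V>. U \<notin> leaves \<V> \<E> \<longrightarrow> orthogonal_decomposition U (children \<E> U)) \<and>
     (\<forall>L\<in>leaves \<V> \<E>. dim L = 1)"

definition tree_frontier :: "(real^'n) set set \<Rightarrow> (real^'n) set set \<Rightarrow> bool" where
  "tree_frontier \<V> F \<longleftrightarrow> orthogonal_decomposition UNIV F \<and> F \<subseteq> \<V>"

definition refinement :: "('v \<times> 'v) set \<Rightarrow> 'v \<Rightarrow> 'v set" where
  "refinement \<E> U = (if children \<E> U = {} then {U} else children \<E> U)"

section \<open>Smoothness and derivatives\<close>

definition twice_continuously_differentiable ::
    "('a::real_normed_vector \<Rightarrow> 'b::real_normed_vector) \<Rightarrow> bool" where
  "twice_continuously_differentiable f \<longleftrightarrow>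
     (\<exists>(f' :: 'a \<Rightarrow> 'a \<Rightarrow>\<^sub>L 'b) (f'' :: 'a \<Rightarrow> 'a \<Rightarrow>\<^sub>L ('a \<Rightarrow>\<^sub>L 'b)).
        (\<forall>x. (f has_derivative blinfun_apply (f' x)) (at x)) \<and>
        (\<forall>x. (f' has_derivative blinfun_apply (f'' x)) (at x)) \<and>
        continuous_on UNIV f'')"

text \<open>The column vector \<open>(\<partial>g/\<partial>x)\<^sup>T\<close>.\<close>

definition gradient :: "(real^'n \<Rightarrow> real) \<Rightarrow> real^'n \<Rightarrow> real^'n" where
  "gradient g x = (\<chi> k. frechet_derivative g (at x) (axis k 1))"

section \<open>The refined basis\<close>

text \<open>
  The number of columns of the refined basis \<open>V\<close> changes from one iteration to the next, so \<open>V\<close>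
  is not a matrix type: it is given by its columns, indexed by the pairs in \<open>index_set F\<close>.
  Reduced vectors are real functions on pairs; only their values on \<open>index_set F\<close> matter.
\<close>

type_synonym ('n, 'p) index = "'p \<times> (real^'n) set"

definition index_set :: "('p \<Rightarrow> (real^'n) set set) \<Rightarrow> ('n, 'p) index set" where
  "index_set F = (SIGMA i:UNIV. F i)"

definition basis_vec :: "real^'p^'n \<Rightarrow> ('n, 'p) index \<Rightarrow> real^'n" where
  "basis_vec \<Phi> = (\<lambda>(i, U). orth_proj U (column i \<Phi>))"

text \<open>The product of \<open>V\<close> with a reduced vector, and the entries of \<open>V\<^sup>T w\<close> and of \<open>V\<^sup>T J V\<close>.\<close>

definition basis_mult ::
    "real^'p^'n \<Rightarrow> ('p::finite \<Rightarrow> (real^'n) set set) \<Rightarrow> (('n, 'p) index \<Rightarrow> real) \<Rightarrow> real^'n" where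
  "basis_mult \<Phi> F z = (\<Sum>a\<in>index_set F. z a *\<^sub>R basis_vec \<Phi> a)"

definition basis_transp_mult :: "real^'p^'n \<Rightarrow> real^'n \<Rightarrow> ('n, 'p) index \<Rightarrow> real" where
  "basis_transp_mult \<Phi> w a = basis_vec \<Phi> a \<bullet> w"

definition reduced_matrix ::
    "real^'p^'n \<Rightarrow> real^'n^'n \<Rightarrow> ('n, 'p) index \<Rightarrow> ('n, 'p) index \<Rightarrow> real" where
  "reduced_matrix \<Phi> J a b = basis_vec \<Phi> a \<bullet> (J *v basis_vec \<Phi> b)"

definition basis_range :: "real^'p^'n \<Rightarrow> ('p::finite \<Rightarrow> (real^'n) set set) \<Rightarrow> (real^'n) set" where
  "basis_range \<Phi> F = range (basis_mult \<Phi> F)"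

section \<open>The refinement algorithm\<close>

definition state ::
    "real^'n \<Rightarrow> real^'p^'n \<Rightarrow> ('p::finite \<Rightarrow> (real^'n) set set) \<Rightarrow> (('n, 'p) index \<Rightarrow> real) \<Rightarrow> real^'n"
where
  "state xbar \<Phi> F xhat = xbar + basis_mult \<Phi> F xhat"

text \<open>Solvability up to the reduced-order-model tolerance \<open>\<tau>\<close>; \<open>\<tau> = 0\<close> is an exact solve.\<close>

definition reduced_solution ::
    "(real^'n \<Rightarrow> real^'n) \<Rightarrow> real^'n \<Rightarrow> real^'p^'n \<Rightarrow> real \<Rightarrow>
     ('p::finite \<Rightarrow> (real^'n) set set) \<Rightarrow> (('n, 'p) index \<Rightarrow> real) \<Rightarrow> bool" where
  "reduced_solution r xbar \<Phi> \<tau> F xhat \<longleftrightarrow>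
     L2_set (basis_transp_mult \<Phi> (r (state xbar \<Phi> F xhat))) (index_set F) \<le> \<tau>"

definition coarse_adjoint ::
    "(real^'n \<Rightarrow> real^'n) \<Rightarrow> (real^'n \<Rightarrow> real) \<Rightarrow> real^'p^'n \<Rightarrow>
     ('p::finite \<Rightarrow> (real^'n) set set) \<Rightarrow> real^'n \<Rightarrow> (('n, 'p) index \<Rightarrow> real) \<Rightarrow> bool" where
  "coarse_adjoint r g \<Phi> F x yhat \<longleftrightarrow>
     (\<forall>a\<in>index_set F.
        (\<Sum>b\<in>index_set F. reduced_matrix \<Phi> (jacobian r (at x)) b a * yhat b) =
        basis_transp_mult \<Phi> (gradient g x) a)"

text \<open>The fine indicator at \<open>(i, W)\<close>, where \<open>W\<close> is in the refinement of the coarse vertex \<open>U\<close>.\<close>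

definition fine_indicator ::
    "(real^'n) set set \<Rightarrow> ((real^'n) set \<times> (real^'n) set) set \<Rightarrow> (real^'n \<Rightarrow> real^'n) \<Rightarrow>
     real^'p^'n \<Rightarrow> real^'n \<Rightarrow> (('n, 'p) index \<Rightarrow> real) \<Rightarrow>
     'p \<Rightarrow> (real^'n) set \<Rightarrow> (real^'n) set \<Rightarrow> real" where
  "fine_indicator \<V> \<E> r \<Phi> x yhat i U W =
     (if W \<in> leaves \<V> \<E> then 0
      else \<bar>yhat (i, U) * (orth_proj W (column i \<Phi>) \<bullet> r x)\<bar>)"

definition coarse_indicator ::
    "(real^'n) set set \<Rightarrow> ((real^'n) set \<times> (real^'n) set) set \<Rightarrow> (real^'n \<Rightarrow> real^'n) \<Rightarrow>
     real^'p^'n \<Rightarrow> real^'n \<Rightarrow> (('n, 'p) index \<Rightarrow> real) \<Rightarrow> ('n, 'p) index \<Rightarrow> real" where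
  "coarse_indicator \<V> \<E> r \<Phi> x yhat =
     (\<lambda>(i, U). \<Sum>W\<in>refinement \<E> U. fine_indicator \<V> \<E> r \<Phi> x yhat i U W)"

definition refine_frontiers ::
    "((real^'n) set \<times> (real^'n) set) set \<Rightarrow> (('n, 'p) index \<Rightarrow> real) \<Rightarrow>
     ('p \<Rightarrow> (real^'n) set set) \<Rightarrow> 'p \<Rightarrow> (real^'n) set set" where
  "refine_frontiers \<E> \<delta> F i =
     (let \<eta> = (\<Sum>a\<in>index_set F. \<delta> a) / real (card (index_set F));
          S = {U \<in> F i. \<delta> (i, U) \<ge> \<eta>}
      in (F i - S) \<union> (\<Union>U\<in>S. refinement \<E> U))"

definition stops_at ::
    "(real^'n \<Rightarrow> real^'n) \<Rightarrow> real^'n \<Rightarrow> real^'p^'n \<Rightarrow> real \<Rightarrow>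
     (nat \<Rightarrow> 'p::finite \<Rightarrow> (real^'n) set set) \<Rightarrow> (nat \<Rightarrow> ('n, 'p) index \<Rightarrow> real) \<Rightarrow> nat \<Rightarrow> bool" where
  "stops_at r xbar \<Phi> \<epsilon> F xhat k \<longleftrightarrow> norm (r (state xbar \<Phi> (F k) (xhat k))) < \<epsilon>"

text \<open>Iteration \<open>k\<close> is carried out iff the stopping test failed at all earlier iterations.\<close>

definition reached ::
    "(real^'n \<Rightarrow> real^'n) \<Rightarrow> real^'n \<Rightarrow> real^'p^'n \<Rightarrow> real \<Rightarrow>
     (nat \<Rightarrow> 'p::finite \<Rightarrow> (real^'n) set set) \<Rightarrow> (nat \<Rightarrow> ('n, 'p) index \<Rightarrow> real) \<Rightarrow> nat \<Rightarrow> bool" where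
  "reached r xbar \<Phi> \<epsilon> F xhat k \<longleftrightarrow> (\<forall>j<k. \<not> stops_at r xbar \<Phi> \<epsilon> F xhat j)"

text \<open>
  The sequences \<open>F\<close>, \<open>xhat\<close>, \<open>yhat\<close> of frontiers, reduced solutions and coarse adjoints form a run
  of the algorithm. After termination they are unconstrained; \<open>yhat k\<close> is also unconstrained at
  the terminating iteration. The vectors \<open>xhat k\<close> and \<open>yhat k\<close> may be any solutions of their
  equations, which need not be unique.
\<close>

definition algorithm_run ::
    "(real^'n) set set \<Rightarrow> ((real^'n) set \<times> (real^'n) set) set \<Rightarrow>
     (real^'n \<Rightarrow> real^'n) \<Rightarrow> (real^'n \<Rightarrow> real) \<Rightarrow> real^'n \<Rightarrow> real^'p^'n \<Rightarrow> real \<Rightarrow> real \<Rightarrow>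
     ('p::finite \<Rightarrow> (real^'n) set set) \<Rightarrow>
     (nat \<Rightarrow> 'p \<Rightarrow> (real^'n) set set) \<Rightarrow>
     (nat \<Rightarrow> ('n, 'p) index \<Rightarrow> real) \<Rightarrow> (nat \<Rightarrow> ('n, 'p) index \<Rightarrow> real) \<Rightarrow> bool" where
  "algorithm_run \<V> \<E> r g xbar \<Phi> \<tau> \<epsilon> F\<^sub>0 F xhat yhat \<longleftrightarrow>
     F 0 = F\<^sub>0 \<and>
     (\<forall>k. reached r xbar \<Phi> \<epsilon> F xhat k \<longrightarrow>
        reduced_solution r xbar \<Phi> \<tau> (F k) (xhat k) \<and>
        (\<not> stops_at r xbar \<Phi> \<epsilon> F xhat k \<longrightarrow>
           (let x = state xbar \<Phi> (F k) (xhat k) in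
              coarse_adjoint r g \<Phi> (F k) x (yhat k) \<and>
              F (Suc k) =
                refine_frontiers \<E> (coarse_indicator \<V> \<E> r \<Phi> x (yhat k)) (F k))))"

end

theory Submission
  imports Defs
begin

text \<open>
  Leaves have coarse indicator 0, and some indicator is at least the average. Hence, if some
  frontier contains a non-leaf, then the marked set contains a non-leaf: either the average is
  positive and every marked vertex is a non-leaf, or all indicators vanish and everything is marked.
  So the frontiers keep being refined until they consist of leaves only. Since every frontier
  contains an ancestor of every leaf, each of them then consists of all leaves, and the columns
  \<open>P\<^sub>L \<phi>\<^sub>i\<close> span every leaf and thus the whole space.
\<close>

section \<open>Linear algebra of decompositions, projections and the range of the refined
  basis\<close>

lemma orthogonal_decomposition_subset_span:
  assumes "orthogonal_decomposition W D"
  shows "W \<subseteq> span (\<Union>D)"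
proof
  fix x assume "x \<in> W"
  then have "x \<in> (\<Sum>U\<in>D. U)" and "finite D"
    using assms by (auto simp: orthogonal_decomposition_def)
  then obtain s where "x = sum s D" and "\<forall>U\<in>D. s U \<in> U"
    by (auto simp: set_sum_alt)
  then show "x \<in> span (\<Union>D)"
    by (auto intro!: span_sum intro: span_base)
qed

text \<open>The definite description in \<open>orth_proj\<close> has to be justified. Existence
  comes from orthogonal splitting. For uniqueness, the difference of two candidates lies in
  \<open>U\<close> and is orthogonal to both residuals, hence to itself.\<close>

lemma orth_proj_mem:
  fixes U :: "'a::euclidean_space set"
  assumes "subspace U"
  shows "orth_proj U x \<in> U"
proof -
  obtain p z where p: "p \<in> span U" "\<And>w. w \<in> span U \<Longrightarrow> orthogonal z w" "x = p + z"
    using orthogonal_subspace_decomp_exists[of U x] by metis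
  have "orth_proj U x = p"
    unfolding orth_proj_def
  proof (rule the_equality)
    show "p \<in> U \<and> (\<forall>u\<in>U. orthogonal (x - p) u)"
      using p span_eq_iff[THEN iffD2, OF assms] by auto
  next
    fix q assume q: "q \<in> U \<and> (\<forall>u\<in>U. orthogonal (x - q) u)"
    then have "q - p \<in> U"
      using p(1) assms by (metis span_eq_iff subspace_diff)
    then have "(x - q) \<bullet> (q - p) = 0" and "z \<bullet> (q - p) = 0"
      using q p(2) assms by (auto simp: orthogonal_def span_base)
    then have "(q - p) \<bullet> (q - p) = 0"
      using p(3) by (simp add: algebra_simps)
    then show "q = p" by simp
  qed
  then show ?thesis
    using p(1) assms by (metis span_eq_iff)
qed

lemma basis_range_mem:
  fixes \<Phi> :: "real^'p^'n"
  assumes "finite (index_set F)" and "a \<in> index_set F"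
  shows "basis_vec \<Phi> a \<in> basis_range \<Phi> F"
proof -
  have "(\<Sum>b\<in>index_set F. (if b = a then 1 else 0) *\<^sub>R basis_vec \<Phi> b)
      = (\<Sum>b\<in>index_set F. if b = a then basis_vec \<Phi> b else 0)"
    by (rule sum.cong) auto
  then have "basis_mult \<Phi> F (\<lambda>b. if b = a then 1 else 0) = basis_vec \<Phi> a"
    using assms by (simp add: basis_mult_def)
  then show ?thesis
    unfolding basis_range_def by (metis rangeI)
qed

lemma subspace_basis_range: "subspace (basis_range \<Phi> F)"
proof (rule subspaceI)
  have "basis_mult \<Phi> F (\<lambda>_. 0) = 0" by (simp add: basis_mult_def)
  then show "0 \<in> basis_range \<Phi> F" unfolding basis_range_def by (metis rangeI)
next
  fix x y assume "x \<in> basis_range \<Phi> F" "y \<in> basis_range \<Phi> F"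
  then obtain u v where "x = basis_mult \<Phi> F u" "y = basis_mult \<Phi> F v"
    by (auto simp: basis_range_def)
  then have "x + y = basis_mult \<Phi> F (\<lambda>a. u a + v a)"
    by (simp add: basis_mult_def scaleR_left_distrib sum.distrib)
  then show "x + y \<in> basis_range \<Phi> F" by (simp add: basis_range_def)
next
  fix c x assume "x \<in> basis_range \<Phi> F"
  then obtain u where "x = basis_mult \<Phi> F u" by (auto simp: basis_range_def)
  then have "c *\<^sub>R x = basis_mult \<Phi> F (\<lambda>a. c * u a)"
    by (simp add: basis_mult_def scaleR_sum_right)
  then show "c *\<^sub>R x \<in> basis_range \<Phi> F" by (simp add: basis_range_def)
qed

text \<open>One nonzero vector spans a line. This turns a single nonvanishing projection onto a leaf
  into containment of the whole leaf.\<close>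

lemma dim_1_subset_subspace:
  fixes L :: "'a::euclidean_space set"
  assumes "dim L = 1" and "v \<in> L" and "v \<noteq> 0" and "subspace R" and "v \<in> R"
  shows "L \<subseteq> R"
proof -
  have "L \<subseteq> span {v}"
    using assms by (intro card_ge_dim_independent) (auto simp: dependent_single)
  also have "\<dots> \<subseteq> R"
    using assms by (intro span_minimal) auto
  finally show ?thesis .
qed

section \<open>A weight on vertices that drops under refinement\<close>

text \<open>The base exceeds the number of children of any vertex, and the exponent drops along edges, so
  replacing a vertex by its children decreases the total weight.\<close>

definition descent_weight :: "('v \<times> 'v) set \<Rightarrow> 'v \<Rightarrow> nat" where
  "descent_weight \<E> U = Suc (card \<E>) ^ card (\<E>\<^sup>+ `` {U})"

text \<open>By acyclicity each child has strictly fewer proper descendants than \<open>U\<close>, so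
  its weight is smaller by at least one factor \<open>Suc (card \<E>)\<close>. At most
  \<open>card \<E>\<close> children cannot make up for that factor.\<close>

lemma sum_descent_weight_children:
  assumes "finite \<E>" and "acyclic \<E>"
  shows "(\<Sum>W\<in>children \<E> U. descent_weight \<E> W) < descent_weight \<E> U"
proof (cases "children \<E> U = {}")
  case False
  define d where "d = card (\<E>\<^sup>+ `` {U})"
  have fin: "finite (\<E>\<^sup>+ `` {X})" for X
    using assms(1) by (simp add: finite_Image)
  \<comment> \<open>Keeps the exponent \<open>d - 1\<close> from being truncated at 0.\<close>
  have dpos: "d > 0"
    using False fin by (auto simp: d_def card_gt_0_iff children_def)
  have le: "descent_weight \<E> W \<le> Suc (card \<E>) ^ (d - 1)" if "W \<in> children \<E> U" for W
  proof -
    have UW: "(U, W) \<in> \<E>" using that by (simp add: children_def)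
    have "W \<notin> \<E>\<^sup>+ `` {W}" using assms(2) by (auto simp: acyclic_def)
    moreover have "W \<in> \<E>\<^sup>+ `` {U}" using UW by auto
    moreover have "\<E>\<^sup>+ `` {W} \<subseteq> \<E>\<^sup>+ `` {U}" using UW by auto
    ultimately have "card (\<E>\<^sup>+ `` {W}) < d"
      unfolding d_def by (intro psubset_card_mono fin) blast
    then show ?thesis
      unfolding descent_weight_def by (intro power_increasing) auto
  qed
  have "card (children \<E> U) \<le> card \<E>"
    by (rule card_inj_on_le[where f = "Pair U"]) (auto simp: children_def inj_on_def assms)
  then have "(\<Sum>W\<in>children \<E> U. descent_weight \<E> W) \<le> card \<E> * Suc (card \<E>) ^ (d - 1)"
    using sum_bounded_above[of "children \<E> U" "descent_weight \<E>", OF le]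
    by (metis (no_types, lifting) mult_le_mono1 of_nat_id order_trans)
  also have "\<dots> < Suc (card \<E>) * Suc (card \<E>) ^ (d - 1)" by simp
  also have "\<dots> = descent_weight \<E> U"
    using dpos by (simp add: descent_weight_def d_def flip: power_Suc)
  finally show ?thesis .
qed (simp add: descent_weight_def)

text \<open>Refined pieces may coincide with each other or with kept vertices, which only lowers the
  sum. With an upper bound in place of an equality, frontiers need not be shown to remain orthogonal
  decompositions.\<close>

lemma sum_replace_le:
  fixes w :: "'v \<Rightarrow> nat"
  assumes "finite A" and "S \<subseteq> A" and "\<And>U. U \<in> S \<Longrightarrow> finite (R U)"
  shows "sum w ((A - S) \<union> (\<Union>U\<in>S. R U)) \<le> sum w (A - S) + (\<Sum>U\<in>S. sum w (R U))"
proof -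
  have fS: "finite S" using assms finite_subset by blast
  have "sum w (\<Union>U\<in>S. R U) \<le> (\<Sum>U\<in>S. sum w (R U))"
    using fS assms(3)
  proof (induction S rule: finite_induct)
    case (insert U S)
    have "sum w (R U \<union> (\<Union>U\<in>S. R U)) \<le> sum w (R U) + sum w (\<Union>U\<in>S. R U)"
      using insert by (subst sum_Un_nat) auto
    then show ?case using insert by force
  qed simp
  moreover have "sum w ((A - S) \<union> (\<Union>U\<in>S. R U)) \<le> sum w (A - S) + sum w (\<Union>U\<in>S. R U)"
    using assms fS by (subst sum_Un_nat) auto
  ultimately show ?thesis by simp
qed

section \<open>Ancestors, leaves and orthogonality in a refinement tree\<close>

context
  fixes \<V> :: "(real^'n) set set" and \<E> :: "((real^'n) set \<times> (real^'n) set) set"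
  assumes tree: "refinement_tree \<V> \<E>"
begin

lemma tree_finite: "finite \<V>" "finite \<E>"
  using tree finite_subset[of \<E> "\<V> \<times> \<V>"] by (auto simp: refinement_tree_def)

text \<open>The first form gives induction from parents to children, the second from children to
  parents.\<close>

lemma tree_wf: "wf \<E>" "wf (\<E>\<inverse>)"
  using tree tree_finite(2)
  by (auto simp: refinement_tree_def finite_acyclic_wf finite_acyclic_wf_converse)

lemma tree_edge_mem: "(U, W) \<in> \<E> \<Longrightarrow> U \<in> \<V> \<and> W \<in> \<V>"
  using tree by (auto simp: refinement_tree_def)

lemma tree_decomposition:
  assumes "(U, W) \<in> \<E>"
  shows "orthogonal_decomposition U (children \<E> U)"
proof -
  have "U \<in> \<V>" and "U \<notin> leaves \<V> \<E>"
    using assms tree_edge_mem by (auto simp: leaves_def children_def)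
  then show ?thesis using tree by (auto simp: refinement_tree_def)
qed

lemma tree_edge_subset: "(U, W) \<in> \<E> \<Longrightarrow> W \<subseteq> U"
  using tree_decomposition[of U W] by (auto simp: orthogonal_decomposition_def children_def)

lemma tree_descendant_subset: "(U, W) \<in> \<E>\<^sup>* \<Longrightarrow> W \<subseteq> U"
  by (induction rule: rtrancl_induct) (use tree_edge_subset in blast)+

lemma tree_parent:
  assumes "W \<in> \<V>" and "W \<noteq> UNIV"
  obtains U where "(U, W) \<in> \<E>"
proof -
  have "card {U. (U, W) \<in> \<E>} = 1"
    using tree assms by (auto simp: refinement_tree_def)
  then show ?thesis using that by (auto simp: card_1_singleton_iff)
qed

lemma tree_root_reaches: "W \<in> \<V> \<Longrightarrow> (UNIV, W) \<in> \<E>\<^sup>*"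
proof (induction W rule: wf_induct_rule[OF tree_wf(1)])
  case (1 W)
  show ?case
  proof (cases "W = UNIV")
    case False
    then obtain U where "(U, W) \<in> \<E>" using tree_parent 1 by metis
    then show ?thesis using 1 tree_edge_mem by (meson rtrancl.rtrancl_into_rtrancl)
  qed simp
qed

text \<open>Induction downwards from the root. If the parent \<open>Y\<close> of \<open>X\<close> is
  orthogonal to \<open>L\<close>, so is \<open>X\<close>. If \<open>Y\<close> is an ancestor of
  \<open>L\<close>, then \<open>L\<close> lies below some child \<open>Z\<close> of
  \<open>Y\<close>: either \<open>Z = X\<close>, or \<open>X\<close> is orthogonal to its sibling
  \<open>Z\<close>, which contains \<open>L\<close>.\<close>

lemma tree_ancestor_or_orthogonal:
  assumes "L \<in> leaves \<V> \<E>"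
  shows "X \<in> \<V> \<Longrightarrow> (X, L) \<in> \<E>\<^sup>* \<or> (\<forall>x\<in>X. \<forall>l\<in>L. orthogonal x l)"
proof (induction X rule: wf_induct_rule[OF tree_wf(1)])
  case (1 X)
  show ?case
  proof (cases "X = UNIV")
    case True
    then show ?thesis using tree_root_reaches assms by (auto simp: leaves_def)
  next
    case False
    then obtain Y where YX: "(Y, X) \<in> \<E>" using tree_parent 1 by metis
    consider "(Y, L) \<in> \<E>\<^sup>*" | "\<forall>y\<in>Y. \<forall>l\<in>L. orthogonal y l"
      using 1 YX tree_edge_mem by blast
    then show ?thesis
    proof cases
      case 1
      \<comment> \<open>A leaf has no child \<open>X\<close>, so the path from \<open>Y\<close> to
        \<open>L\<close> has a first edge.\<close>
      have "Y \<noteq> L" using YX assms by (auto simp: leaves_def children_def)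
      then obtain Z where Z: "(Y, Z) \<in> \<E>" "(Z, L) \<in> \<E>\<^sup>*"
        using 1 by (meson converse_rtranclE)
      show ?thesis
      proof (cases "Z = X")
        case False
        then have "\<forall>x\<in>X. \<forall>z\<in>Z. orthogonal x z"
          using tree_decomposition[OF YX] YX Z
          by (auto simp: orthogonal_decomposition_def pairwise_def children_def)
        then show ?thesis using tree_descendant_subset[OF Z(2)] by blast
      qed (use Z in simp)
    next
      case 2
      then show ?thesis using tree_edge_subset[OF YX] by blast
    qed
  qed
qed

lemma leaf_dim: "L \<in> leaves \<V> \<E> \<Longrightarrow> dim L = 1"
  using tree by (auto simp: refinement_tree_def)

lemma leaf_subspace: "L \<in> leaves \<V> \<E> \<Longrightarrow> subspace L"
  using tree by (auto simp: refinement_tree_def leaves_def)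

text \<open>Otherwise all members of the frontier are orthogonal to \<open>L\<close>. As they span
  the whole space, \<open>L\<close> would be orthogonal to itself, hence zero.\<close>

lemma leaf_ancestor_in_frontier:
  assumes "tree_frontier \<V> A" and L: "L \<in> leaves \<V> \<E>"
  shows "\<exists>U\<in>A. (U, L) \<in> \<E>\<^sup>*"
proof (rule ccontr)
  assume "\<not> ?thesis"
  then have orth: "\<And>U x l. U \<in> A \<Longrightarrow> x \<in> U \<Longrightarrow> l \<in> L \<Longrightarrow> orthogonal l x"
    using tree_ancestor_or_orthogonal[OF L] assms(1)
    unfolding tree_frontier_def by (metis orthogonal_commute subsetD)
  have "l = 0" if "l \<in> L" for l
  proof -
    have "l \<in> span (\<Union>A)"
      using orthogonal_decomposition_subset_span assms(1) by (auto simp: tree_frontier_def)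
    then have "orthogonal l l"
      using orth that by (intro orthogonal_to_span[of l "\<Union>A" l]) auto
    then show ?thesis by (simp add: orthogonal_def)
  qed
  then have "dim L = 0" by auto
  then show False using leaf_dim[OF L] by simp
qed

text \<open>Induction upwards from the leaves, since an inner vertex is spanned by its children. It
  is applied to the root, with the range of the refined basis as \<open>R\<close>.\<close>

lemma leaves_span:
  assumes "subspace R" and "\<And>L. L \<in> leaves \<V> \<E> \<Longrightarrow> L \<subseteq> R"
  shows "U \<in> \<V> \<Longrightarrow> U \<subseteq> R"
proof (induction U rule: wf_induct_rule[OF tree_wf(2)])
  case (1 U)
  show ?case
  proof (cases "U \<in> leaves \<V> \<E>")
    case False
    then obtain W where "(U, W) \<in> \<E>" using 1 by (auto simp: leaves_def children_def)
    then have "U \<subseteq> span (\<Union>(children \<E> U))"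
      by (intro orthogonal_decomposition_subset_span tree_decomposition)
    also have "\<dots> \<subseteq> R"
      using 1 tree_edge_mem assms(1) by (intro span_minimal) (auto simp: children_def)
    finally show ?thesis .
  qed (use assms in blast)
qed

section \<open>Effect of refinement and marking on the frontiers\<close>

lemma refinement_subset: "U \<in> \<V> \<Longrightarrow> refinement \<E> U \<subseteq> \<V>"
  using tree_edge_mem by (auto simp: refinement_def children_def)

lemma sum_descent_weight_refinement:
  "sum (descent_weight \<E>) (refinement \<E> U) \<le> descent_weight \<E> U"
  "children \<E> U \<noteq> {} \<Longrightarrow> sum (descent_weight \<E>) (refinement \<E> U) < descent_weight \<E> U"
  using sum_descent_weight_children[of \<E> U] tree tree_finite
  by (auto simp: refinement_def refinement_tree_def less_imp_le)

lemma refinement_ancestor: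
  assumes "(U, L) \<in> \<E>\<^sup>*" and "L \<in> leaves \<V> \<E>"
  shows "\<exists>W\<in>refinement \<E> U. (W, L) \<in> \<E>\<^sup>*"
proof (cases "children \<E> U = {}")
  case False
  then have "U \<noteq> L" using assms by (auto simp: leaves_def)
  then show ?thesis
    using False assms(1) by (auto simp: refinement_def children_def elim: converse_rtranclE)
qed (use assms in \<open>auto simp: refinement_def\<close>)

lemma refine_frontiers_subset:
  assumes "A i \<subseteq> \<V>"
  shows "refine_frontiers \<E> \<delta> A i \<subseteq> \<V>"
  using assms refinement_subset by (auto simp: refine_frontiers_def Let_def subset_iff)

text \<open>A path from a refined vertex down to \<open>L\<close> passes through one of its
  children, or the vertex is \<open>L\<close> itself and is kept. This invariant carries the
  covering property of frontiers through the run.\<close>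

lemma refine_frontiers_ancestor:
  assumes "\<exists>U\<in>A i. (U, L) \<in> \<E>\<^sup>*" and "L \<in> leaves \<V> \<E>"
  shows "\<exists>U\<in>refine_frontiers \<E> \<delta> A i. (U, L) \<in> \<E>\<^sup>*"
  using assms refinement_ancestor[OF _ assms(2)]
  unfolding refine_frontiers_def Let_def by blast

lemma refine_frontiers_leaves:
  assumes "A i \<subseteq> leaves \<V> \<E>"
  shows "refine_frontiers \<E> \<delta> A i \<subseteq> leaves \<V> \<E>"
  using assms by (auto simp: refine_frontiers_def Let_def refinement_def leaves_def)

text \<open>If every non-leaf were below the average, the nonnegative value at
  \<open>U\<^sub>0\<close> would force the average to be positive. The leaves, with value 0, would
  then be below it too, and all values would lie strictly below their own average.\<close>

lemma marked_nonleaf: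
  fixes A :: "'p::finite \<Rightarrow> (real^'n) set set" and \<delta> :: "('n, 'p) index \<Rightarrow> real"
  defines "\<eta> \<equiv> (\<Sum>a\<in>index_set A. \<delta> a) / real (card (index_set A))"
  assumes A: "\<And>i. A i \<subseteq> \<V>"
    and nonneg: "\<And>i U. U \<in> A i \<Longrightarrow> 0 \<le> \<delta> (i, U)"
    and leaf: "\<And>i U. U \<in> leaves \<V> \<E> \<Longrightarrow> \<delta> (i, U) = 0"
    and nonleaf: "U\<^sub>0 \<in> A i\<^sub>0" "U\<^sub>0 \<notin> leaves \<V> \<E>"
  shows "\<exists>i. \<exists>U\<in>A i. U \<notin> leaves \<V> \<E> \<and> \<eta> \<le> \<delta> (i, U)"
proof (rule ccontr)
  assume "\<not> ?thesis"
  then have small: "\<And>i U. U \<in> A i \<Longrightarrow> U \<notin> leaves \<V> \<E> \<Longrightarrow> \<delta> (i, U) < \<eta>" by force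
  have "finite (A i)" for i using A tree_finite(1) finite_subset by blast
  then have fin: "finite (index_set A)" by (simp add: index_set_def)
  have pos: "0 < \<eta>" using small[OF nonleaf] nonneg[OF nonleaf(1)] by simp
  have "(\<Sum>a\<in>index_set A. \<delta> a) < (\<Sum>a\<in>index_set A. \<eta>)"
  proof (rule sum_strict_mono[OF fin])
    show "index_set A \<noteq> {}" using nonleaf by (auto simp: index_set_def)
  next
    fix a assume "a \<in> index_set A"
    then obtain i U where "a = (i, U)" "U \<in> A i" by (auto simp: index_set_def)
    then show "\<delta> a < \<eta>" using small leaf pos by (cases "U \<in> leaves \<V> \<E>") auto
  qed
  moreover have "card (index_set A) \<noteq> 0"
    using fin nonleaf by (auto simp: index_set_def)
  ultimately show False by (simp add: \<eta>_def)
qed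

text \<open>Refining never raises the weight of a vertex and strictly lowers that of a non-leaf.
  \<open>marked_nonleaf\<close> supplies at least one marked non-leaf.\<close>

lemma refine_frontiers_decreases:
  fixes A :: "'p::finite \<Rightarrow> (real^'n) set set" and \<delta> :: "('n, 'p) index \<Rightarrow> real"
  assumes A: "\<And>i. A i \<subseteq> \<V>"
    and nonneg: "\<And>i U. U \<in> A i \<Longrightarrow> 0 \<le> \<delta> (i, U)"
    and leaf: "\<And>i U. U \<in> leaves \<V> \<E> \<Longrightarrow> \<delta> (i, U) = 0"
    and nonleaf: "\<not> A i\<^sub>0 \<subseteq> leaves \<V> \<E>"
  shows "(\<Sum>i\<in>UNIV. sum (descent_weight \<E>) (refine_frontiers \<E> \<delta> A i))
       < (\<Sum>i\<in>UNIV. sum (descent_weight \<E>) (A i))"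
proof -
  let ?w = "descent_weight \<E>"
  define \<eta> where "\<eta> = (\<Sum>a\<in>index_set A. \<delta> a) / real (card (index_set A))"
  define S where "S i = {U \<in> A i. \<eta> \<le> \<delta> (i, U)}" for i
  have finA: "finite (A i)" for i using A tree_finite(1) finite_subset by blast
  have SA: "S i \<subseteq> A i" for i by (auto simp: S_def)
  have finS: "finite (S i)" for i using finA SA finite_subset by blast
  have finR: "finite (refinement \<E> U)" if "U \<in> S i" for i U
    using that SA A refinement_subset tree_finite(1) by (meson finite_subset subsetD)
  have le: "sum ?w (refine_frontiers \<E> \<delta> A i)
      \<le> sum ?w (A i - S i) + (\<Sum>U\<in>S i. sum ?w (refinement \<E> U))" for i
    using sum_replace_le[OF finA SA finR, of i]
    by (simp add: refine_frontiers_def Let_def S_def \<eta>_def)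
  have split: "sum ?w (A i) = sum ?w (A i - S i) + sum ?w (S i)" for i
    using sum.subset_diff[OF SA finA] by simp
  have weak: "sum ?w (refine_frontiers \<E> \<delta> A i) \<le> sum ?w (A i)" for i
  proof -
    have "(\<Sum>U\<in>S i. sum ?w (refinement \<E> U)) \<le> sum ?w (S i)"
      by (intro sum_mono sum_descent_weight_refinement(1))
    then show ?thesis using le[of i] split[of i] by linarith
  qed
  obtain U\<^sub>0 where "U\<^sub>0 \<in> A i\<^sub>0" "U\<^sub>0 \<notin> leaves \<V> \<E>" using nonleaf by blast
  from marked_nonleaf[of A \<delta>, OF A nonneg leaf this]
  obtain i U where U: "U \<in> S i" "U \<notin> leaves \<V> \<E>"
    unfolding S_def \<eta>_def by blast
  then have "children \<E> U \<noteq> {}" using SA A unfolding leaves_def by blast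
  then have "(\<Sum>U\<in>S i. sum ?w (refinement \<E> U)) < sum ?w (S i)"
    using U(1) sum_descent_weight_refinement by (intro sum_strict_mono_ex1[OF finS]) blast+
  then have "sum ?w (refine_frontiers \<E> \<delta> A i) < sum ?w (A i)"
    using le[of i] split[of i] by linarith
  then show ?thesis using weak by (intro sum_strict_mono_ex1[OF finite]) blast+
qed

lemma coarse_indicator_nonneg: "0 \<le> coarse_indicator \<V> \<E> r \<Phi> x yhat a"
  by (auto simp: coarse_indicator_def fine_indicator_def split: prod.split intro!: sum_nonneg)

lemma coarse_indicator_leaf:
  "U \<in> leaves \<V> \<E> \<Longrightarrow> coarse_indicator \<V> \<E> r \<Phi> x yhat (i, U) = 0"
  by (simp add: coarse_indicator_def fine_indicator_def refinement_def leaves_def)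

text \<open>Each \<open>A i\<close> contains every leaf, so for each leaf \<open>L\<close> the
  column at \<open>(i, L)\<close> with nonzero projection is present. It spans \<open>L\<close>, and
  the leaves together span the root.\<close>

lemma basis_range_leaf_frontiers:
  fixes \<Phi> :: "real^'p^'n"
  assumes leaves: "\<And>i. A i \<subseteq> leaves \<V> \<E>"
    and anc: "\<And>i L. L \<in> leaves \<V> \<E> \<Longrightarrow> \<exists>U\<in>A i. (U, L) \<in> \<E>\<^sup>*"
    and proj: "\<And>L. L \<in> leaves \<V> \<E> \<Longrightarrow> \<exists>i. orth_proj L (column i \<Phi>) \<noteq> 0"
  shows "basis_range \<Phi> A = UNIV"
proof -
  have "leaves \<V> \<E> \<subseteq> \<V>" by (auto simp: leaves_def)
  then have "finite (A i)" for i
    using leaves tree_finite(1) by (meson finite_subset subset_trans)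
  then have fin: "finite (index_set A)" by (simp add: index_set_def)
  have "L \<subseteq> basis_range \<Phi> A" if L: "L \<in> leaves \<V> \<E>" for L
  proof -
    obtain i where i: "orth_proj L (column i \<Phi>) \<noteq> 0" using proj L by blast
    obtain U where U: "U \<in> A i" "(U, L) \<in> \<E>\<^sup>*" using anc L by blast
    \<comment> \<open>The frontier member above \<open>L\<close> is a leaf, so the path from it to
      \<open>L\<close> is empty.\<close>
    have "children \<E> U = {}" using U(1) leaves by (auto simp: leaves_def)
    then have "U = L" using U(2) by (auto simp: children_def elim: converse_rtranclE)
    then have "(i, L) \<in> index_set A" using U(1) by (simp add: index_set_def)
    from basis_range_mem[OF fin this, of \<Phi>]
    have "orth_proj L (column i \<Phi>) \<in> basis_range \<Phi> A" by (simp add: basis_vec_def)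
    then show ?thesis
      using dim_1_subset_subspace[OF leaf_dim[OF L] orth_proj_mem i subspace_basis_range]
        leaf_subspace[OF L] by blast
  qed
  moreover have "UNIV \<in> \<V>" using tree by (simp add: refinement_tree_def)
  ultimately show ?thesis using leaves_span[OF subspace_basis_range] by blast
qed

end

section \<open>Termination of the refinement and convergence of the range\<close>

theorem theorem5p4:
  fixes \<V> :: "(real^'n) set set"
    and \<E> :: "((real^'n) set \<times> (real^'n) set) set"
    and r :: "real^'n \<Rightarrow> real^'n"
    and g :: "real^'n \<Rightarrow> real"
    and xbar :: "real^'n"
    and \<Phi> :: "real^'p^'n"
    and \<tau> \<epsilon> :: real
    and F\<^sub>0 :: "'p \<Rightarrow> (real^'n) set set"
    and F :: "nat \<Rightarrow> 'p \<Rightarrow> (real^'n) set set"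
    and xhat yhat :: "nat \<Rightarrow> 'p \<times> (real^'n) set \<Rightarrow> real"
  assumes "refinement_tree \<V> \<E>"
    and "twice_continuously_differentiable r"
    and "twice_continuously_differentiable g"
    and "rank \<Phi> = CARD('p)"
    and "\<tau> \<ge> 0"
    and "\<epsilon> > 0"
    and "\<And>i. tree_frontier \<V> (F\<^sub>0 i)"
    and "\<And>L. L \<in> leaves \<V> \<E> \<Longrightarrow> \<exists>i. orth_proj L (column i \<Phi>) \<noteq> 0"
    and "algorithm_run \<V> \<E> r g xbar \<Phi> \<tau> \<epsilon> F\<^sub>0 F xhat yhat"
  shows "(\<exists>k. reached r xbar \<Phi> \<epsilon> F xhat k \<and>
               norm (r (state xbar \<Phi> (F k) (xhat k))) < \<epsilon>) \<or>
         (\<exists>K. \<forall>k\<ge>K. reached r xbar \<Phi> \<epsilon> F xhat k \<and> basis_range \<Phi> (F k) = UNIV)"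
proof (rule disj_imp[THEN iffD2, OF impI])
  note tree = assms(1)
  assume nostop: "\<not> (\<exists>k. reached r xbar \<Phi> \<epsilon> F xhat k \<and>
      norm (r (state xbar \<Phi> (F k) (xhat k))) < \<epsilon>)"
  \<comment> \<open>Without a successful stopping test every iteration is carried out, so the update
    rule holds for all \<open>k\<close>.\<close>
  have reached: "reached r xbar \<Phi> \<epsilon> F xhat k" for k
  proof (induction k)
    case (Suc k)
    then have "\<not> stops_at r xbar \<Phi> \<epsilon> F xhat k" using nostop by (auto simp: stops_at_def)
    then show ?case using Suc by (auto simp: reached_def less_Suc_eq)
  qed (simp add: reached_def)
  define \<delta> where "\<delta> k = coarse_indicator \<V> \<E> r \<Phi> (state xbar \<Phi> (F k) (xhat k)) (yhat k)" for k
  have step: "F (Suc k) = refine_frontiers \<E> (\<delta> k) (F k)" for k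
    using assms(9) reached nostop
    unfolding algorithm_run_def \<delta>_def Let_def stops_at_def by blast
  have F0: "F 0 = F\<^sub>0" using assms(9) by (simp add: algorithm_run_def)
  have FV: "F k i \<subseteq> \<V>" for k i
  proof (induction k)
    case 0
    then show ?case using assms(7) by (simp add: F0 tree_frontier_def)
  next
    case (Suc k)
    then show ?case unfolding step by (rule refine_frontiers_subset[OF tree])
  qed
  have anc: "\<exists>U\<in>F k i. (U, L) \<in> \<E>\<^sup>*" if L: "L \<in> leaves \<V> \<E>" for k i L
  proof (induction k)
    case 0
    then show ?case using leaf_ancestor_in_frontier[OF tree assms(7) L] by (simp add: F0)
  next
    case (Suc k)
    then show ?case unfolding step by (rule refine_frontiers_ancestor[OF tree _ L])
  qed
  \<comment> \<open>Total weight over all frontiers, a natural number that must drop as long as some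
    frontier contains a non-leaf.\<close>
  define \<mu> where "\<mu> k = (\<Sum>i\<in>UNIV. sum (descent_weight \<E>) (F k i))" for k
  have dec: "\<mu> (Suc k) < \<mu> k" if "\<not> F k i \<subseteq> leaves \<V> \<E>" for k i
    unfolding \<mu>_def step
    by (rule refine_frontiers_decreases[where A = "F k", OF tree FV _ _ that])
      (simp_all add: \<delta>_def coarse_indicator_nonneg[OF tree] coarse_indicator_leaf[OF tree])
  \<comment> \<open>If no such \<open>K\<close> existed, \<open>\<mu>\<close> would decrease at
    every iteration. The identity sequence would then be an infinite descending chain for
    \<open>measure \<mu>\<close>.\<close>
  obtain K where K: "\<And>i. F K i \<subseteq> leaves \<V> \<E>"
    using dec wf_no_infinite_down_chainE[OF wf_measure, of \<mu> "\<lambda>k. k"]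
    by (metis in_measure)
  \<comment> \<open>A leaf refines to itself, so frontiers made of leaves stay so. This gives the
    conclusion for all later iterations rather than for \<open>K\<close> alone.\<close>
  have "F k i \<subseteq> leaves \<V> \<E>" if "K \<le> k" for k i
    using that
  proof (induction k rule: dec_induct)
    case (step k)
    then show ?case
      unfolding \<open>\<And>k. F (Suc k) = refine_frontiers \<E> (\<delta> k) (F k)\<close>
      by (intro refine_frontiers_leaves[OF tree])
  qed (rule K)
  then have "basis_range \<Phi> (F k) = UNIV" if "K \<le> k" for k
    using that by (intro basis_range_leaf_frontiers[OF tree _ anc assms(8)])
  then show "\<exists>K. \<forall>k\<ge>K. reached r xbar \<Phi> \<epsilon> F xhat k \<and> basis_range \<Phi> (F k) = UNIV"
    using reached by blast
qed

end
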